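(* Let $\mathcal{R}$ be an associative ring with unit $1\neq 0$, let $a,x\in\mathcal{R}$, let $\mathcal{T}$ be a right ideal of $\mathcal{R}$ and let $\mathcal{T}'$ be a left ideal of $\mathcal{R}$. Then the following statements are equivalent: (1) $x\in a\{2\}$, ${\rm rann}(x)=\mathcal{T}$, and ${\rm lann}(x)=\mathcal{T}'$. (2) $\varphi_{ax}=\rho_{ax\mathcal{R},\mathcal{T}}$, ${}_{xa}\varphi=\rho_{\mathcal{R}xa,\mathcal{T}'}$, and ${\rm rann}(a)\cap x\mathcal{R}=\{0\}$. (3) $\varphi_{ax}=\rho_{ax\mathcal{R},\mathcal{T}}$, ${}_{xa}\varphi=\rho_{\mathcal{R}xa,\mathcal{T}'}$, and ${\rm lann}(a)\cap\mathcal{R}x=\{0\}$. (4) $\varphi_{ax}=\rho_{ax\mathcal{R},\mathcal{T}}$, ${}_{xa}\varphi=\rho_{\mathcal{R}xa,\mathcal{T}'}$, and $\mathcal{T}\subseteq{\rm rann}(x)$. (5) $\varphi_{ax}=\rho_{ax\mathcal{R},\mathcal{T}}$, ${}_{xa}\varphi=\rho_{\mathcal{R}xa,\mathcal{T}'}$, and $\mathcal{T}'\subseteq{\rm lann}(x)$. (6) $1-ax\in\mathcal{T}$, $xt=0$ for all $t\in\mathcal{T}$, $1-xa\in\mathcal{T}'$, and $tx=0$ for all $t\in\mathcal{T}'$. Moreover, for given $a,\mathcal{T},\mathcal{T}'$, if an element $x\in a\{2\}$ with ${\rm rann}(x)=\mathcal{T}$ and ${\rm lann}(x)=\mathcal{T}'$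 exists, then it is unique.
   Context: Notation: $a\{2\}=\{x\in\mathcal{R}:xax=x\}$; $a\mathcal{R}=\{ar:r\in\mathcal{R}\}$, $\mathcal{R}a=\{ra:r\in\mathcal{R}\}$, ${\rm rann}(a)=\{r\in\mathcal{R}:ar=0\}$, ${\rm lann}(a)=\{r\in\mathcal{R}:ra=0\}$. The additive group endomorphisms $\varphi_a,{}_a\varphi:\mathcal{R}\to\mathcal{R}$ are $\varphi_a(r)=ar$ and ${}_a\varphi(r)=ra$. For additive subgroups $\mathcal{S},\mathcal{T}$ of $\mathcal{R}$, $\mathcal{R}=\mathcal{S}\oplus\mathcal{T}$ means $\mathcal{R}=\mathcal{S}+\mathcal{T}$ and $\mathcal{S}\cap\mathcal{T}=\{0\}$; in that case $\rho_{\mathcal{S},\mathcal{T}}:\mathcal{R}\to\mathcal{R}$ is the group endomorphism $\rho_{\mathcal{S},\mathcal{T}}(s+t)=s$ for $s\in\mathcal{S}$, $t\in\mathcal{T}$. Convention: whenever $\rho_{\mathcal{S},\mathcal{T}}$ is written, it is implicitly asserted that $\mathcal{R}=\mathcal{S}\oplus\mathcal{T}$. *)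

theory Defs
  imports Main "HOL-Library.Set_Algebras"
begin

text \<open>Rings are types of class \<open>ring_1\<close>: associative, with unit, \<open>0 \<noteq> 1\<close>, not
  necessarily commutative.\<close>

definition add_subgroup :: "'a::ring_1 set \<Rightarrow> bool" where
  "add_subgroup S \<longleftrightarrow> 0 \<in> S \<and> (\<forall>s\<in>S. \<forall>t\<in>S. s + t \<in> S) \<and> (\<forall>s\<in>S. - s \<in> S)"

definition right_ideal :: "'a::ring_1 set \<Rightarrow> bool" where
  "right_ideal I \<longleftrightarrow> add_subgroup I \<and> (\<forall>i\<in>I. \<forall>r. i * r \<in> I)"

definition left_ideal :: "'a::ring_1 set \<Rightarrow> bool" where
  "left_ideal I \<longleftrightarrow> add_subgroup I \<and> (\<forall>i\<in>I. \<forall>r. r * i \<in> I)"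

definition outer_inverses :: "'a::ring_1 \<Rightarrow> 'a set" where
  "outer_inverses a = {x. x * a * x = x}"

definition right_principal :: "'a::ring_1 \<Rightarrow> 'a set" where
  "right_principal a = {a * r | r. True}"

definition left_principal :: "'a::ring_1 \<Rightarrow> 'a set" where
  "left_principal a = {r * a | r. True}"

definition rann :: "'a::ring_1 \<Rightarrow> 'a set" where
  "rann a = {r. a * r = 0}"

definition lann :: "'a::ring_1 \<Rightarrow> 'a set" where
  "lann a = {r. r * a = 0}"

text \<open>The maps written \<open>\<phi>\<close> with \<open>a\<close> as right and as left subscript, respectively.\<close>

definition phi_left :: "'a::ring_1 \<Rightarrow> 'a \<Rightarrow> 'a" where
  "phi_left a = (\<lambda>r. a * r)"

definition phi_right :: "'a::ring_1 \<Rightarrow> 'a \<Rightarrow> 'a" where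
  "phi_right a = (\<lambda>r. r * a)"

definition ring_direct_sum :: "'a::ring_1 set \<Rightarrow> 'a set \<Rightarrow> bool" where
  "ring_direct_sum S T \<longleftrightarrow>
     add_subgroup S \<and> add_subgroup T \<and> S + T = UNIV \<and> S \<inter> T = {0}"

text \<open>\<open>proj_along S T\<close> is meaningful only under \<open>ring_direct_sum S T\<close>, which makes the
  component \<open>s\<close> below exist uniquely.\<close>

definition proj_along :: "'a::ring_1 set \<Rightarrow> 'a set \<Rightarrow> 'a \<Rightarrow> 'a" where
  "proj_along S T r = (THE s. s \<in> S \<and> (\<exists>t\<in>T. r = s + t))"

text \<open>The equation \<open>f = \<rho>\<^bsub>S,T\<^esub>\<close>, under the convention that writing \<open>\<rho>\<^bsub>S,T\<^esub>\<close> also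
  asserts that the ring is the direct sum of \<open>S\<close> and \<open>T\<close>.\<close>

definition equals_proj :: "('a::ring_1 \<Rightarrow> 'a) \<Rightarrow> 'a set \<Rightarrow> 'a set \<Rightarrow> bool" where
  "equals_proj f S T \<longleftrightarrow> ring_direct_sum S T \<and> f = proj_along S T"

end

theory Submission
  imports Defs
begin

text \<open>
  The projection conditions only speak about idempotents: an additive map \<open>f\<close> is the
  projection onto its range along \<open>T\<close> exactly when \<open>f \<circ> f = f\<close> and \<open>T\<close> is the kernel of \<open>f\<close>
  (\<open>equals_proj_range_iff\<close>).  Applied to multiplication by \<open>a x\<close> and by \<open>x a\<close>, the two equations
  shared by conditions \<open>S2\<close> to \<open>S5\<close> say that \<open>a x\<close> and \<open>x a\<close> are idempotent with
  \<open>rann (a x) = T\<close> and \<open>lann (x a) = T'\<close>.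

  If \<open>x a x = x\<close>, then \<open>a x\<close> and \<open>x a\<close> are idempotent and have the same annihilators as \<open>x\<close>, on
  the right and on the left respectively.  So \<open>S1\<close> is the two equations together with \<open>x a x = x\<close>,
  and it remains to see that each extra condition in \<open>S2\<close> to \<open>S5\<close> is, given the equations, another
  way to write \<open>x a x = x\<close>.  This is because the defect \<open>x - x a x = x (1 - a x) = (1 - x a) x\<close>
  lies in \<open>x R\<close> and in \<open>R x\<close>, is annihilated by \<open>a\<close> on both sides as soon as \<open>a x\<close> and \<open>x a\<close> are
  idempotent, and is the product of \<open>x\<close> with an element of \<open>T\<close> on one side, of \<open>T'\<close> on the other.

  Condition \<open>S6\<close> is the pointwise form: \<open>x (1 - a x) = 0\<close> is again \<open>x a x = x\<close>, and since \<open>T\<close> and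
  \<open>T'\<close> are ideals, containing \<open>1 - a x\<close> and \<open>1 - x a\<close> forces them to contain the annihilators.

  Uniqueness: if \<open>y\<close> and \<open>z\<close> are outer inverses of \<open>a\<close> with the same annihilators, then
  \<open>z (1 - a y) = 0\<close> and \<open>(1 - z a) y = 0\<close>, so \<open>z = z a y = y\<close>.
\<close>

section \<open>Additive projections\<close>

lemma proj_along_eqI:
  assumes "ring_direct_sum S T" "s \<in> S" "t \<in> T" "r = s + t"
  shows "proj_along S T r = s"
  unfolding proj_along_def
proof (rule the_equality)
  show "s \<in> S \<and> (\<exists>t\<in>T. r = s + t)"
    using assms by blast
next
  fix s' assume "s' \<in> S \<and> (\<exists>t\<in>T. r = s' + t)"
  then obtain t' where s': "s' \<in> S" and t': "t' \<in> T" "r = s' + t'"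
    by blast
  have S: "add_subgroup S" and T: "add_subgroup T" and ST: "S \<inter> T = {0}"
    using assms(1) by (auto simp: ring_direct_sum_def)
  have "s' + - s \<in> S"
    using S s' assms(2) unfolding add_subgroup_def by blast
  moreover have "t + - t' \<in> T"
    using T t' assms(3) unfolding add_subgroup_def by blast
  moreover have "s' + - s = t + - t'"
    using t'(2) assms(4) by (simp add: algebra_simps)
  ultimately have "s' + - s \<in> S \<inter> T"
    by simp
  then show "s' = s"
    using ST by simp
qed

text \<open>
  If \<open>f\<close> is the projection, it fixes its own range and its zeros are the elements with zero
  component, i.e. those of \<open>T\<close>.  Conversely, an idempotent \<open>f\<close> splits the ring by
  \<open>r = f r + (r - f r)\<close>.  Stating this for additive maps covers left and right multiplication at
  once.
\<close>

lemma equals_proj_range_iff: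
  fixes f :: "'a::ring_1 \<Rightarrow> 'a"
  assumes add: "\<And>r s. f (r + s) = f r + f s"
  shows "equals_proj f (range f) T \<longleftrightarrow> (\<forall>r. f (f r) = f r) \<and> {r. f r = 0} = T"
proof -
  have zero: "f 0 = 0"
    using add[of 0 0] by simp
  have minus: "f (- r) = - f r" for r
    using add[of r "- r"] zero by (simp add: eq_neg_iff_add_eq_0 add.commute)
  have diff: "f (r - s) = f r - f s" for r s
    using add[of r "- s"] minus by simp
  show ?thesis
  proof
    assume "equals_proj f (range f) T"
    then have ds: "ring_direct_sum (range f) T" and f: "f = proj_along (range f) T"
      by (auto simp: equals_proj_def)
    have zero_T: "0 \<in> T"
      using ds by (auto simp: ring_direct_sum_def add_subgroup_def)
    have f_eq: "f (s + t) = s" if "s \<in> range f" "t \<in> T" for s t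
      using proj_along_eqI[OF ds that refl] f by simp
    have idem: "f (f r) = f r" for r
      using f_eq[of "f r" 0] zero_T by simp
    have "r \<in> T" if "f r = 0" for r
    proof -
      obtain s t where "s \<in> range f" "t \<in> T" "r = s + t"
        using ds by (metis UNIV_I ring_direct_sum_def set_plus_elim)
      with that f_eq show ?thesis
        by simp
    qed
    moreover have "f t = 0" if "t \<in> T" for t
      using f_eq[of 0 t] that zero by (metis add_0 rangeI)
    ultimately show "(\<forall>r. f (f r) = f r) \<and> {r. f r = 0} = T"
      using idem by blast
  next
    assume "(\<forall>r. f (f r) = f r) \<and> {r. f r = 0} = T"
    then have idem: "f (f r) = f r" and T: "T = {r. f r = 0}" for r
      by auto
    have ker: "r - f r \<in> T" for r
      by (simp add: T diff idem)
    have "add_subgroup (range f)"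
      unfolding add_subgroup_def using rangeI[of f 0] by (auto simp: zero simp flip: add minus)
    moreover have "add_subgroup T"
      unfolding add_subgroup_def T by (simp add: zero add minus)
    moreover have "range f + T = UNIV"
    proof -
      have "f r + (r - f r) \<in> range f + T" for r
        using ker by (intro set_plus_intro) simp_all
      then show ?thesis
        by auto
    qed
    moreover have "range f \<inter> T = {0}"
      using zero idem by (force simp: T)
    ultimately have ds: "ring_direct_sum (range f) T"
      by (simp add: ring_direct_sum_def)
    have "f r = proj_along (range f) T r" for r
      by (rule proj_along_eqI[OF ds rangeI ker[of r], symmetric]) simp
    then have "f = proj_along (range f) T"
      by (rule ext)
    with ds show "equals_proj f (range f) T"
      unfolding equals_proj_def by (rule conjI)
  qed
qed

section \<open>Multiplication maps as projections\<close>

text \<open>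
  For a multiplication map, idempotency of the map is idempotency of the element (evaluate at 1),
  and the kernel is an annihilator.
\<close>

lemma equals_proj_phi_left_iff:
  "equals_proj (phi_left p) (right_principal p) T \<longleftrightarrow> p * p = p \<and> rann p = T"
proof -
  have "right_principal p = range (phi_left p)"
    by (auto simp: right_principal_def phi_left_def)
  moreover have "(\<forall>r. p * (p * r) = p * r) \<longleftrightarrow> p * p = p"
    by (auto simp flip: mult.assoc dest: spec[of _ 1])
  ultimately show ?thesis
    using equals_proj_range_iff[of "phi_left p" T]
    by (simp add: phi_left_def rann_def distrib_left)
qed

lemma equals_proj_phi_right_iff:
  "equals_proj (phi_right p) (left_principal p) T \<longleftrightarrow> p * p = p \<and> lann p = T"
proof -
  have "left_principal p = range (phi_right p)"
    by (auto simp: left_principal_def phi_right_def)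
  moreover have "(\<forall>r. r * p * p = r * p) \<longleftrightarrow> p * p = p"
    by (auto simp: mult.assoc dest: spec[of _ 1])
  ultimately show ?thesis
    using equals_proj_range_iff[of "phi_right p" T]
    by (simp add: phi_right_def lann_def distrib_right)
qed

section \<open>Outer inverses\<close>

lemma outer_inverse_rann:
  assumes "x * a * x = x"
  shows "rann (a * x) = rann x"
proof -
  have "a * x * r = 0 \<longleftrightarrow> x * r = 0" for r
    using arg_cong[OF assms, of "\<lambda>y. y * r"] by (auto simp: mult.assoc)
  then show ?thesis
    by (simp add: rann_def)
qed

lemma outer_inverse_lann:
  assumes "x * a * x = x"
  shows "lann (x * a) = lann x"
proof -
  have "r * (x * a) = 0 \<longleftrightarrow> r * x = 0" for r
    using arg_cong[OF assms, of "\<lambda>y. r * y"] by (auto simp flip: mult.assoc)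
  then show ?thesis
    by (simp add: lann_def)
qed

text \<open>
  The four criteria below recover \<open>x a x = x\<close>.  In the first two, the defect \<open>x - x a x\<close> belongs to
  the intersection that is assumed to be trivial; in the last two, it is the product
  of \<open>x\<close> with the complementary idempotent, and that idempotent lies in the annihilator assumed
  to be contained in that of \<open>x\<close>.
\<close>

lemma outer_inverse_iff_rann_disjoint:
  assumes "(a * x) * (a * x) = a * x"
  shows "x * a * x = x \<longleftrightarrow> rann a \<inter> right_principal x = {0}"
proof
  assume outer: "x * a * x = x"
  have "x * r = 0" if "a * (x * r) = 0" for r
    using outer_inverse_rann[OF outer] that by (auto simp: rann_def mult.assoc)
  moreover have "0 \<in> right_principal x"
    by (auto simp: right_principal_def intro: exI[of _ 0])
  ultimately show "rann a \<inter> right_principal x = {0}"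
    by (auto simp: rann_def right_principal_def)
next
  assume triv: "rann a \<inter> right_principal x = {0}"
  have "a * (x * (1 - a * x)) = 0"
    using assms by (simp add: algebra_simps)
  then have "x * (1 - a * x) \<in> rann a \<inter> right_principal x"
    by (auto simp: rann_def right_principal_def)
  then show "x * a * x = x"
    using triv by (simp add: algebra_simps)
qed

lemma outer_inverse_iff_lann_disjoint:
  assumes "(x * a) * (x * a) = x * a"
  shows "x * a * x = x \<longleftrightarrow> lann a \<inter> left_principal x = {0}"
proof
  assume outer: "x * a * x = x"
  have "r * x = 0" if "r * x * a = 0" for r
    using outer_inverse_lann[OF outer] that by (auto simp: lann_def simp flip: mult.assoc)
  moreover have "0 \<in> left_principal x"
    by (auto simp: left_principal_def intro: exI[of _ 0])
  ultimately show "lann a \<inter> left_principal x = {0}"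
    by (auto simp: lann_def left_principal_def)
next
  assume triv: "lann a \<inter> left_principal x = {0}"
  have "(1 - x * a) * x * a = 0"
    using assms by (simp add: algebra_simps)
  then have "(1 - x * a) * x \<in> lann a \<inter> left_principal x"
    by (auto simp: lann_def left_principal_def)
  then show "x * a * x = x"
    using triv by (simp add: algebra_simps)
qed

lemma outer_inverse_iff_rann_subset:
  assumes "(a * x) * (a * x) = a * x"
  shows "x * a * x = x \<longleftrightarrow> rann (a * x) \<subseteq> rann x"
proof
  assume "rann (a * x) \<subseteq> rann x"
  moreover have "1 - a * x \<in> rann (a * x)"
    using assms by (simp add: rann_def algebra_simps)
  ultimately have "x * (1 - a * x) = 0"
    by (auto simp: rann_def)
  then show "x * a * x = x"
    by (simp add: algebra_simps)
qed (simp add: outer_inverse_rann)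

lemma outer_inverse_iff_lann_subset:
  assumes "(x * a) * (x * a) = x * a"
  shows "x * a * x = x \<longleftrightarrow> lann (x * a) \<subseteq> lann x"
proof
  assume "lann (x * a) \<subseteq> lann x"
  moreover have "1 - x * a \<in> lann (x * a)"
    using assms by (simp add: lann_def algebra_simps)
  ultimately have "(1 - x * a) * x = 0"
    by (auto simp: lann_def)
  then show "x * a * x = x"
    by (simp add: algebra_simps)
qed (simp add: outer_inverse_lann)

text \<open>
  An element that annihilates \<open>x\<close> is fixed by the complementary idempotent, so an ideal containing
  \<open>1 - a x\<close> (or \<open>1 - x a\<close> on the left) already contains the whole annihilator of \<open>x\<close>.
\<close>

lemma outer_inverse_annihilators_iff:
  assumes "right_ideal T" and "left_ideal T'"
  shows "x * a * x = x \<and> rann x = T \<and> lann x = T' \<longleftrightarrow>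
    1 - a * x \<in> T \<and> (\<forall>t\<in>T. x * t = 0) \<and> 1 - x * a \<in> T' \<and> (\<forall>t\<in>T'. t * x = 0)"
    (is "?outer \<longleftrightarrow> ?complement")
proof
  assume ?outer
  then show ?complement
    by (auto simp: rann_def lann_def algebra_simps)
next
  assume complement: ?complement
  then have "x * (1 - a * x) = 0"
    by blast
  then have "x * a * x = x"
    by (simp add: algebra_simps)
  moreover have "r \<in> T" if "x * r = 0" for r
  proof -
    have "(1 - a * x) * r \<in> T"
      using assms(1) complement by (auto simp: right_ideal_def)
    then show ?thesis
      using that by (simp add: algebra_simps)
  qed
  moreover have "r \<in> T'" if "r * x = 0" for r
  proof -
    have "r * (1 - x * a) \<in> T'"
      using assms(2) complement by (auto simp: left_ideal_def)
    moreover have "r * (x * a) = 0"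
      using that by (simp flip: mult.assoc)
    ultimately show ?thesis
      by (simp add: right_diff_distrib)
  qed
  ultimately show ?outer
    using complement by (auto simp: rann_def lann_def)
qed

lemma outer_inverse_unique:
  assumes "y * a * y = y" "z * a * z = z" "rann y = rann z" "lann y = lann z"
  shows "y = z"
proof -
  have "1 - a * y \<in> rann z"
    unfolding assms(3)[symmetric] using assms(1) by (simp add: rann_def algebra_simps)
  moreover have "1 - z * a \<in> lann y"
    unfolding assms(4) using assms(2) by (simp add: lann_def algebra_simps)
  ultimately have "z = z * a * y" and "y = z * a * y"
    by (simp_all add: rann_def lann_def algebra_simps)
  then show ?thesis
    by simp
qed

section \<open>Outer inverses with prescribed annihilators\<close>

theorem theorem5p6:
  fixes a x :: "'a::ring_1" and T T' :: "'a set"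
  assumes "right_ideal T" and "left_ideal T'"
  shows
    "(let
        S1 = (x \<in> outer_inverses a \<and> rann x = T \<and> lann x = T');
        S2 = (equals_proj (phi_left (a * x)) (right_principal (a * x)) T \<and>
              equals_proj (phi_right (x * a)) (left_principal (x * a)) T' \<and>
              rann a \<inter> right_principal x = {0});
        S3 = (equals_proj (phi_left (a * x)) (right_principal (a * x)) T \<and>
              equals_proj (phi_right (x * a)) (left_principal (x * a)) T' \<and>
              lann a \<inter> left_principal x = {0});
        S4 = (equals_proj (phi_left (a * x)) (right_principal (a * x)) T \<and>
              equals_proj (phi_right (x * a)) (left_principal (x * a)) T' \<and>
              T \<subseteq> rann x);
        S5 = (equals_proj (phi_left (a * x)) (right_principal (a * x)) T \<and>
              equals_proj (phi_right (x * a)) (left_principal (x * a)) T' \<and>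
              T' \<subseteq> lann x);
        S6 = (1 - a * x \<in> T \<and> (\<forall>t\<in>T. x * t = 0) \<and>
              1 - x * a \<in> T' \<and> (\<forall>t\<in>T'. t * x = 0))
      in (S1 \<longleftrightarrow> S2) \<and> (S1 \<longleftrightarrow> S3) \<and> (S1 \<longleftrightarrow> S4) \<and> (S1 \<longleftrightarrow> S5) \<and> (S1 \<longleftrightarrow> S6)) \<and>
     (\<forall>y z. y \<in> outer_inverses a \<and> rann y = T \<and> lann y = T' \<and>
            z \<in> outer_inverses a \<and> rann z = T \<and> lann z = T' \<longrightarrow> y = z)"
proof -
  let ?projections =
    "equals_proj (phi_left (a * x)) (right_principal (a * x)) T \<and>
     equals_proj (phi_right (x * a)) (left_principal (x * a)) T'"
  have projections: "?projections \<longleftrightarrow>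
      (a * x) * (a * x) = a * x \<and> rann (a * x) = T \<and>
      (x * a) * (x * a) = x * a \<and> lann (x * a) = T'"
    by (auto simp: equals_proj_phi_left_iff equals_proj_phi_right_iff)
  have outer_idem: "(a * x) * (a * x) = a * x \<and> (x * a) * (x * a) = x * a" if "x * a * x = x"
    using that by (simp flip: mult.assoc) (simp add: mult.assoc)
  have one: "x * a * x = x \<and> rann x = T \<and> lann x = T' \<longleftrightarrow> ?projections \<and> x * a * x = x"
    using outer_idem outer_inverse_rann[of x a] outer_inverse_lann[of x a]
    unfolding projections by auto
  have two: "x * a * x = x \<longleftrightarrow> rann a \<inter> right_principal x = {0}"
    and three: "x * a * x = x \<longleftrightarrow> lann a \<inter> left_principal x = {0}"
    and four: "x * a * x = x \<longleftrightarrow> T \<subseteq> rann x"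
    and five: "x * a * x = x \<longleftrightarrow> T' \<subseteq> lann x"
    if ?projections
  proof -
    have ax: "(a * x) * (a * x) = a * x" "rann (a * x) = T"
      and xa: "(x * a) * (x * a) = x * a" "lann (x * a) = T'"
      using that projections by simp_all
    show "x * a * x = x \<longleftrightarrow> rann a \<inter> right_principal x = {0}"
      by (rule outer_inverse_iff_rann_disjoint[OF ax(1)])
    show "x * a * x = x \<longleftrightarrow> lann a \<inter> left_principal x = {0}"
      by (rule outer_inverse_iff_lann_disjoint[OF xa(1)])
    show "x * a * x = x \<longleftrightarrow> T \<subseteq> rann x"
      by (rule outer_inverse_iff_rann_subset[OF ax(1), unfolded ax(2)])
    show "x * a * x = x \<longleftrightarrow> T' \<subseteq> lann x"
      by (rule outer_inverse_iff_lann_subset[OF xa(1), unfolded xa(2)])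
  qed
  note six = outer_inverse_annihilators_iff[OF assms, of x a]
  have unique: "y = z" if "y * a * y = y \<and> rann y = T \<and> lann y = T' \<and>
      z * a * z = z \<and> rann z = T \<and> lann z = T'" for y z
    using that by (intro outer_inverse_unique[of y a z]) simp_all
  show ?thesis
    unfolding Let_def outer_inverses_def mem_Collect_eq
  proof (intro conjI)
    show "\<forall>y z. y * a * y = y \<and> rann y = T \<and> lann y = T' \<and>
        z * a * z = z \<and> rann z = T \<and> lann z = T' \<longrightarrow> y = z"
      using unique by blast
  qed (use one two in argo, use one three in argo, use one four in argo,
      use one five in argo, rule six)
qed

end
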